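(* Consider the problem $f_0^*=\min_{x\in Q}\{f_0(x):\ f_i(x)\le0,\ i=1,\dots,m\}$, with an optimal solution $x^*$. Let $\{x_k\}_{k\ge0}$ be generated by the Fixed-Step Switching Subgradient Method described in the context with step bounds $h_k=\sqrt{2D}\,\tau_k$, $k\ge0$, where $\tau_k\ge\tau_{k+1}>0$ for all $k\ge0$ and $\sum_{k=0}^\infty\tau_k^2=+\infty$. Let $a(\cdot)$ be the divergence delay of $\{\tau_k\}$, and for $N\ge1+a(0)$ let $k(N)=\max\{k\ge0:\ k+a(k)\le N-1\}$. Then for any $N\ge1+a(0)$ the set $\mathcal{A}_0(N)$ is not empty. Moreover, if $\|f_i'(x)\|_*\le M_i$ for all $x\in Q$ and $i=0,\dots,m$, then for all $k\in\mathcal{A}_0(N)$ $$f_i(x_k)\ \le\ \|f_i'(x_k)\|_*h_k\ \le\ M_ih_{k(N)},\qquad i=1,\dots,m,$$ and $$\frac{1}{\sigma_0(N)}\sum_{k\in\mathcal{A}_0(N)}\lambda_kf_0(x_k)\ \le\ \phi(\bar\lambda^*(N))+M_0h_{k(N)}.$$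
   Context: $\mathbb{E}$ is a finite-dimensional real vector space with dual $\mathbb{E}^*$, $\langle s,x\rangle$ is the value of $s\in\mathbb{E}^*$ at $x$, $\|\cdot\|$ is an arbitrary norm on $\mathbb{E}$ and $\|g\|_*=\max\{\langle g,x\rangle:\|x\|\le1\}$. The functions $f_0,\dots,f_m$ are closed, convex and subdifferentiable on $Q$; $Q\subset\mathbb{E}$ is closed, convex and bounded; $f_i'(x)$ is a fixed subgradient of $f_i$ at $x\in Q$. Write $\bar f(x)=(f_1(x),\dots,f_m(x))^T$. Prox-function: $d$ is continuously differentiable on a convex open domain $\mathrm{dom}\,d\supseteq Q$ with $d(y)\ge d(x)+\langle\nabla d(x),y-x\rangle+\frac12\|y-x\|^2$. Bregman distance: $\beta_d(x,y)=d(y)-d(x)-\langle\nabla d(x),y-x\rangle$. The constant $D$ satisfies $\beta_d(x,y)<D$ for all $x,y\in Q$. Dual function: $\phi(\bar\lambda)=\min_{x\in Q}\{f_0(x)+\langle\bar\lambda,\bar f(x)\rangle\}$, $\bar\lambda\in\mathbb{R}^m_+$. For $x\in Q$, $\lambda\ge0$, $i=0,\dots,m$: $\varphi_{i,x}(\lambda)=\max_{T\in Q}\{\lambda\langle f_i'(x),x-T\rangle-\beta_d(x,T)\}$, with maximizer $T_{i,x}(\lambda)$. The number $\lambda_{i,k}>0$ is a solution of $\varphi_{i,x_k}(\lambda_{i,k})=\frac12h_k^2$; these solutions are assumed to exist. Fixed-Step Switching Subgradient Method: choose $x_0\in Q$ and positive $\{h_k\}_{k\ge0}$. For $k\ge0$: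 (1) compute $\lambda_{i,k}$ and $T_{i,x_k}(\lambda_{i,k})$ for $1\le i\le m$. (2) If there is $i\in\{1,\dots,m\}$ with $\lambda_{i,k}f_i(x_k)\ge h_k^2$, pick such an $i$ and set $i_k=i$, $x_{k+1}=T_{i,x_k}(\lambda_{i,k})$. (3) Otherwise set $i_k=0$, compute $\lambda_{0,k}$ and set $x_{k+1}=T_{0,x_k}(\lambda_{0,k})$. (4) Set $\lambda_k=\lambda_{i_k,k}$. Divergence delay: $a(k)\ge0$ is the minimal nonnegative integer such that $\sum_{i=k}^{k+a(k)}\tau_i^2\ge1$. Further notation: $\mathcal{A}_i(N)=\{k:\ k(N)\le k\le N-1,\ i_k=i\}$ and $\sigma_i(N)=\sum_{k\in\mathcal{A}_i(N)}\lambda_k$ for $i=0,\dots,m$ (empty sums are zero); $\lambda_i^*(N)=\sigma_i(N)/\sigma_0(N)$ for $i=1,\dots,m$, and $\bar\lambda^*(N)=(\lambda_1^*(N),\dots,\lambda_m^*(N))$, defined when $\mathcal{A}_0(N)\ne\emptyset$. *)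

theory Defs
  imports "HOL-Analysis.Analysis"
begin

text \<open>
  The space is a type \<open>'a::real_normed_vector\<close>, so that \<open>norm\<close> is an arbitrary norm; finite
  dimension is an explicit hypothesis. In finite dimension every linear functional is bounded,
  and the dual space is \<open>'a \<Rightarrow>\<^sub>L real\<close>. Maxima and minima are written as \<open>SUP\<close> and
  \<open>INF\<close>; they are bounded and attained when \<open>Q\<close> is compact and nonempty, the functions are
  closed and convex on \<open>Q\<close>, and the multipliers are nonnegative.
\<close>

definition finite_dimensional :: "'a::real_vector itself \<Rightarrow> bool" where
  "finite_dimensional _ \<longleftrightarrow> (\<exists>B::'a set. finite B \<and> span B = UNIV)"

definition dual_norm :: "('a::real_normed_vector \<Rightarrow>\<^sub>L real) \<Rightarrow> real" where
  "dual_norm g = (SUP x\<in>cball 0 1. blinfun_apply g x)"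

lemma dual_norm_eq_norm: "dual_norm g = norm g"
proof (rule antisym)
  have le: "blinfun_apply g x \<le> norm g" if "x \<in> cball 0 1" for x
  proof -
    have "blinfun_apply g x \<le> norm g * norm x"
      using norm_blinfun[of g x] by (simp add: abs_le_iff)
    also have "\<dots> \<le> norm g * 1" using that by (intro mult_left_mono) auto
    finally show ?thesis by simp
  qed
  then show "dual_norm g \<le> norm g" unfolding dual_norm_def by (intro cSUP_least) auto
  have bdd: "bdd_above (blinfun_apply g ` cball 0 1)" using le by (intro bdd_aboveI2) auto
  have up: "blinfun_apply g x \<le> dual_norm g" if "x \<in> cball 0 1" for x
    unfolding dual_norm_def by (rule cSUP_upper[OF that bdd])
  have nn: "0 \<le> dual_norm g" using up[of 0] by (simp add: blinfun.zero_right)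
  show "norm g \<le> dual_norm g"
  proof (rule norm_blinfun_bound[OF nn])
    fix x
    show "norm (blinfun_apply g x) \<le> dual_norm g * norm x"
    proof (cases "x = 0")
      case False
      have "blinfun_apply g (sgn x) \<le> dual_norm g" "blinfun_apply g (- sgn x) \<le> dual_norm g"
        using up[of "sgn x"] up[of "- sgn x"] by (auto simp: norm_sgn)
      with False show ?thesis
        by (auto simp: sgn_div_norm blinfun.scaleR_right blinfun.minus_right abs_if field_simps)
    qed (simp add: blinfun.zero_right)
  qed
qed

text \<open>
  Functions are only considered on \<open>Q\<close>, so the subgradient inequality is required at the
  points of \<open>Q\<close>; for a convex function with a larger domain this follows from the inequality
  on the whole domain.
\<close>

definition is_subgradient_on ::
  "'a::real_normed_vector set \<Rightarrow> ('a \<Rightarrow> real) \<Rightarrow> 'a \<Rightarrow> ('a \<Rightarrow>\<^sub>L real) \<Rightarrow> bool" where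
  "is_subgradient_on Q f x g \<longleftrightarrow> (\<forall>y\<in>Q. f y \<ge> f x + blinfun_apply g (y - x))"

text \<open>\<open>X\<close> is the domain of the prox-function \<open>d\<close> and \<open>grad\<close> its gradient.\<close>

definition prox_function ::
  "'a::real_normed_vector set \<Rightarrow> ('a \<Rightarrow> real) \<Rightarrow> ('a \<Rightarrow> ('a \<Rightarrow>\<^sub>L real)) \<Rightarrow> bool" where
  "prox_function X d grad \<longleftrightarrow>
     open X \<and> convex X \<and>
     (\<forall>x\<in>X. (d has_derivative blinfun_apply (grad x)) (at x)) \<and>
     continuous_on X grad \<and>
     (\<forall>x\<in>X. \<forall>y\<in>X. d y \<ge> d x + blinfun_apply (grad x) (y - x) + 1/2 * (norm (y - x))\<^sup>2)"

definition bregman ::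
  "('a::real_normed_vector \<Rightarrow> real) \<Rightarrow> ('a \<Rightarrow> ('a \<Rightarrow>\<^sub>L real)) \<Rightarrow> 'a \<Rightarrow> 'a \<Rightarrow> real" where
  "bregman d grad x y = d y - d x - blinfun_apply (grad x) (y - x)"

definition dual_function ::
  "'a set \<Rightarrow> nat \<Rightarrow> (nat \<Rightarrow> 'a \<Rightarrow> real) \<Rightarrow> (nat \<Rightarrow> real) \<Rightarrow> real" where
  "dual_function Q m f l = (INF x\<in>Q. f 0 x + (\<Sum>i=1..m. l i * f i x))"

definition step_objective ::
  "('a::real_normed_vector \<Rightarrow> real) \<Rightarrow> ('a \<Rightarrow> ('a \<Rightarrow>\<^sub>L real)) \<Rightarrow> ('a \<Rightarrow>\<^sub>L real) \<Rightarrow> 'a \<Rightarrow> real \<Rightarrow> 'a \<Rightarrow> real"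
  where
  "step_objective d grad g x l T = l * blinfun_apply g (x - T) - bregman d grad x T"

definition step_value ::
  "'a::real_normed_vector set \<Rightarrow> ('a \<Rightarrow> real) \<Rightarrow> ('a \<Rightarrow> ('a \<Rightarrow>\<^sub>L real)) \<Rightarrow> ('a \<Rightarrow>\<^sub>L real) \<Rightarrow> 'a \<Rightarrow> real \<Rightarrow> real"
  where
  "step_value Q d grad g x l = (SUP T\<in>Q. step_objective d grad g x l T)"

definition is_step_point ::
  "'a::real_normed_vector set \<Rightarrow> ('a \<Rightarrow> real) \<Rightarrow> ('a \<Rightarrow> ('a \<Rightarrow>\<^sub>L real)) \<Rightarrow> ('a \<Rightarrow>\<^sub>L real) \<Rightarrow> 'a \<Rightarrow> real \<Rightarrow> 'a \<Rightarrow> bool"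
  where
  "is_step_point Q d grad g x l T \<longleftrightarrow> is_arg_max (step_objective d grad g x l) (\<lambda>T. T \<in> Q) T"

definition is_step_length ::
  "'a::real_normed_vector set \<Rightarrow> ('a \<Rightarrow> real) \<Rightarrow> ('a \<Rightarrow> ('a \<Rightarrow>\<^sub>L real)) \<Rightarrow> ('a \<Rightarrow>\<^sub>L real) \<Rightarrow> 'a \<Rightarrow> real \<Rightarrow> real \<Rightarrow> bool"
  where
  "is_step_length Q d grad g x h l \<longleftrightarrow> l > 0 \<and> step_value Q d grad g x l = 1/2 * h\<^sup>2"

text \<open>
  A run of the method: \<open>h\<close> are the step bounds, \<open>x\<close> the iterates, \<open>lam i k\<close> the solution
  \<open>\<lambda>\<^sub>i\<^sub>,\<^sub>k\<close> of the step equation, and \<open>idx k\<close> the selected index \<open>i\<^sub>k\<close>. The number \<open>lam 0 k\<close>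
  is only constrained when it is computed, that is, when no constraint is selected.
\<close>

definition switching_subgradient_run ::
  "'a::real_normed_vector set \<Rightarrow> ('a \<Rightarrow> real) \<Rightarrow> ('a \<Rightarrow> ('a \<Rightarrow>\<^sub>L real)) \<Rightarrow> nat \<Rightarrow>
   (nat \<Rightarrow> 'a \<Rightarrow> real) \<Rightarrow> (nat \<Rightarrow> 'a \<Rightarrow> ('a \<Rightarrow>\<^sub>L real)) \<Rightarrow> (nat \<Rightarrow> real) \<Rightarrow>
   (nat \<Rightarrow> 'a) \<Rightarrow> (nat \<Rightarrow> nat \<Rightarrow> real) \<Rightarrow> (nat \<Rightarrow> nat) \<Rightarrow> bool" where
  "switching_subgradient_run Q d grad m f f' h x lam idx \<longleftrightarrow>
     x 0 \<in> Q \<and> (\<forall>k. h k > 0) \<and>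
     (\<forall>k.
        (\<forall>i\<in>{1..m}. is_step_length Q d grad (f' i (x k)) (x k) (h k) (lam i k)) \<and>
        (if \<exists>i\<in>{1..m}. lam i k * f i (x k) \<ge> (h k)\<^sup>2
         then idx k \<in> {1..m} \<and> lam (idx k) k * f (idx k) (x k) \<ge> (h k)\<^sup>2
         else idx k = 0 \<and> is_step_length Q d grad (f' 0 (x k)) (x k) (h k) (lam 0 k)) \<and>
        is_step_point Q d grad (f' (idx k) (x k)) (x k) (lam (idx k) k) (x (Suc k)))"

definition divergence_delay :: "(nat \<Rightarrow> real) \<Rightarrow> nat \<Rightarrow> nat" where
  "divergence_delay \<tau> k = (LEAST a. (\<Sum>i=k..k+a. (\<tau> i)\<^sup>2) \<ge> 1)"

text \<open>The index \<open>k(N)\<close>, for \<open>N \<ge> 1 + divergence_delay \<tau> 0\<close>.\<close>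

definition window_start :: "(nat \<Rightarrow> real) \<Rightarrow> nat \<Rightarrow> nat" where
  "window_start \<tau> N = Max {k. k + divergence_delay \<tau> k \<le> N - 1}"

definition active_steps :: "(nat \<Rightarrow> real) \<Rightarrow> (nat \<Rightarrow> nat) \<Rightarrow> nat \<Rightarrow> nat \<Rightarrow> nat set" where
  "active_steps \<tau> idx N i = {k. window_start \<tau> N \<le> k \<and> k \<le> N - 1 \<and> idx k = i}"

definition active_weight ::
  "(nat \<Rightarrow> real) \<Rightarrow> (nat \<Rightarrow> nat \<Rightarrow> real) \<Rightarrow> (nat \<Rightarrow> nat) \<Rightarrow> nat \<Rightarrow> nat \<Rightarrow> real" where
  "active_weight \<tau> lam idx N i = (\<Sum>k\<in>active_steps \<tau> idx N i. lam (idx k) k)"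

definition dual_multiplier ::
  "(nat \<Rightarrow> real) \<Rightarrow> (nat \<Rightarrow> nat \<Rightarrow> real) \<Rightarrow> (nat \<Rightarrow> nat) \<Rightarrow> nat \<Rightarrow> nat \<Rightarrow> real" where
  "dual_multiplier \<tau> lam idx N i = active_weight \<tau> lam idx N i / active_weight \<tau> lam idx N 0"

end

theory Submission
  imports Defs
begin

text \<open>
  The optimality condition of a Bregman step with step length \<open>\<lambda>\<^sub>k\<close> gives
  \<open>\<lambda>\<^sub>k \<langle>g\<^sub>k, x\<^sub>k - y\<rangle> \<le> \<beta>(x\<^sub>k, y) - \<beta>(x\<^sub>k\<^sub>+\<^sub>1, y) + h\<^sub>k\<^sup>2/2\<close> for all \<open>y \<in> Q\<close>.
  Summed over the window \<open>k(N) \<le> k < N\<close>, the Bregman terms telescope to less than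
  \<open>D \<le> D \<Sum> \<tau>\<^sub>k\<^sup>2 = \<Sum> h\<^sub>k\<^sup>2/2\<close>, so the left-hand sides add up to less than \<open>\<Sum> h\<^sub>k\<^sup>2\<close>.
  A step on a constraint contributes at least \<open>h\<^sub>k\<^sup>2 - \<lambda>\<^sub>k f\<^sub>i(y)\<close> by the subgradient inequality,
  which cancels its share of the right-hand side. Strong convexity of \<open>d\<close> gives
  \<open>h\<^sub>k \<le> \<lambda>\<^sub>k \<parallel>g\<^sub>k\<parallel>\<close>, which turns the remaining \<open>h\<^sub>k\<^sup>2\<close> into \<open>\<lambda>\<^sub>k M\<^sub>0 h\<^sub>k\<close>.
\<close>

section \<open>Bregman distances and single steps of the method\<close>

lemma prox_function_derivative:
  assumes "prox_function X d grad" "x \<in> X"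
  shows "(d has_derivative blinfun_apply (grad x)) (at x)"
  using assms by (simp add: prox_function_def)

lemma bregman_ge:
  assumes "prox_function X d grad" "x \<in> X" "y \<in> X"
  shows "1/2 * (norm (y - x))\<^sup>2 \<le> bregman d grad x y"
proof -
  have "d y \<ge> d x + blinfun_apply (grad x) (y - x) + 1/2 * (norm (y - x))\<^sup>2"
    using assms by (simp add: prox_function_def)
  then show ?thesis by (simp add: bregman_def)
qed

lemma bregman_nonneg:
  assumes "prox_function X d grad" "x \<in> X" "y \<in> X"
  shows "0 \<le> bregman d grad x y"
  using bregman_ge[OF assms] by (rule order_trans[rotated]) simp

lemma is_step_pointD:
  assumes "is_step_point Q d grad g x l T"
  shows "T \<in> Q" "\<And>S. S \<in> Q \<Longrightarrow> step_objective d grad g x l S \<le> step_objective d grad g x l T"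
  using assms by (auto simp: is_step_point_def is_arg_max_linorder)

lemma step_value_eq:
  assumes "is_step_point Q d grad g x l T"
  shows "step_value Q d grad g x l = step_objective d grad g x l T"
  unfolding step_value_def by (rule cSup_eq_maximum) (use is_step_pointD[OF assms] in auto)

text \<open>First-order optimality: convexity keeps the segment from \<open>T\<close> to
  \<open>y\<close> inside \<open>Q\<close>, so the objective cannot have a positive derivative at
  \<open>T\<close> in the direction \<open>y - T\<close>. The asserted expression is minus that
  derivative.\<close>

lemma step_point_optimality:
  assumes prox: "prox_function X d grad" and "Q \<subseteq> X" "convex Q"
    and step: "is_step_point Q d grad g x l T" and y: "y \<in> Q"
  shows "0 \<le> l * blinfun_apply g (y - T) + blinfun_apply (grad T) (y - T) - blinfun_apply (grad x) (y - T)"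
proof (rule ccontr)
  define p where "p t = T + t *\<^sub>R (y - T)" for t :: real
  define c where "c = l * blinfun_apply g (y - T) + blinfun_apply (grad T) (y - T) - blinfun_apply (grad x) (y - T)"
  define \<psi> where "\<psi> t = step_objective d grad g x l (p t)" for t
  assume "\<not> ?thesis"
  then have c: "c < 0" by (simp add: c_def)
  have TQ: "T \<in> Q" using is_step_pointD(1)[OF step] .
  then have "T \<in> X" using assms(2) by auto
  have dp: "(p has_derivative (\<lambda>t. t *\<^sub>R (y - T))) (at 0)"
    unfolding p_def by (auto intro!: derivative_eq_intros)
  have "(d has_derivative blinfun_apply (grad T)) (at (p 0))"
    using prox_function_derivative[OF prox \<open>T \<in> X\<close>] by (simp add: p_def)
  then have "((\<lambda>t. d (p t)) has_derivative (\<lambda>t. blinfun_apply (grad T) (t *\<^sub>R (y - T)))) (at 0)"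
    by (rule has_derivative_compose[OF dp])
  then have dd: "((\<lambda>t. d (p t)) has_real_derivative blinfun_apply (grad T) (y - T)) (at 0)"
    by (simp add: has_field_derivative_def blinfun.scaleR_right mult.commute[of _ "blinfun_apply _ _"])
  \<comment> \<open>All terms except \<open>d (p t)\<close> are now affine in \<open>t\<close>, so
    \<open>dd\<close> is the only derivative still required.\<close>
  have \<psi>: "\<psi> t = l * blinfun_apply g (x - T) - l * (t * blinfun_apply g (y - T))
      - (d (p t) - d x - (blinfun_apply (grad x) (T - x) + t * blinfun_apply (grad x) (y - T)))" for t
    by (simp add: \<psi>_def step_objective_def bregman_def p_def blinfun.diff_right blinfun.add_right
        blinfun.scaleR_right algebra_simps)
  have "(\<psi> has_real_derivative - c) (at 0)"
    unfolding \<psi>[abs_def] c_def by (auto intro!: derivative_eq_intros dd)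
  with c obtain e where e: "e > 0" "\<And>t. 0 < t \<Longrightarrow> t < e \<Longrightarrow> \<psi> 0 < \<psi> t"
    using DERIV_pos_inc_right[of \<psi> "- c" 0] by auto
  \<comment> \<open>Half of \<open>e\<close> stays strictly inside the interval of increase; the cap
    1 makes \<open>p t\<close> a convex combination of \<open>T\<close> and
    \<open>y\<close>.\<close>
  define t where "t = min (e / 2) 1"
  have t: "0 < t" "t < e" "t \<le> 1" using e(1) by (auto simp: t_def min_def)
  have "p t = (1 - t) *\<^sub>R T + t *\<^sub>R y" by (simp add: p_def algebra_simps)
  with TQ y t have "p t \<in> Q" using \<open>convex Q\<close> by (simp add: convex_alt)
  then have "\<psi> t \<le> \<psi> 0" using is_step_pointD(2)[OF step] by (simp add: \<psi>_def p_def)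
  with e(2)[of t] t show False by simp
qed

text \<open>The three-point identity \<beta>(x,y) - \<beta>(T,y) - \<beta>(x,T) = \<langle>grad T -
  grad x, y - T\<rangle> turns the optimality condition into a difference of Bregman distances. The
  step equation evaluates what remains, the objective at \<open>T\<close>, as half of the squared
  step bound.\<close>

lemma step_point_descent:
  assumes prox: "prox_function X d grad" and "Q \<subseteq> X" "convex Q"
    and step: "is_step_point Q d grad g x l T" and len: "is_step_length Q d grad g x h l"
    and y: "y \<in> Q"
  shows "l * blinfun_apply g (x - y) \<le> bregman d grad x y - bregman d grad T y + 1/2 * h\<^sup>2"
proof -
  have "step_objective d grad g x l T = 1/2 * h\<^sup>2"
    using step_value_eq[OF step] len by (simp add: is_step_length_def)
  with step_point_optimality[OF prox assms(2,3) step y] show ?thesis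
    by (simp add: step_objective_def bregman_def blinfun.diff_right algebra_simps)
qed

text \<open>With r the distance from \<open>x\<close> to \<open>T\<close>, strong convexity bounds
  the objective by l |g| r - r^2/2, and this quadratic in r never exceeds (l |g|)^2/2. Comparison
  with the step equation gives the claim.\<close>

lemma step_length_ge:
  assumes prox: "prox_function X d grad" and "Q \<subseteq> X" "x \<in> Q"
    and len: "is_step_length Q d grad g x h l" and "0 < h"
  shows "h \<le> l * norm g"
proof -
  have l: "l > 0" using len by (simp add: is_step_length_def)
  have "step_value Q d grad g x l \<le> 1/2 * (l * norm g)\<^sup>2"
    unfolding step_value_def
  proof (rule cSUP_least)
    fix T assume T: "T \<in> Q"
    define r where "r = norm (T - x)"
    have "blinfun_apply g (x - T) \<le> norm g * r"
      using norm_blinfun[of g "x - T"] by (simp add: r_def norm_minus_commute)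
    then have "l * blinfun_apply g (x - T) \<le> l * norm g * r"
      using l by (simp add: mult.assoc)
    moreover have "1/2 * r\<^sup>2 \<le> bregman d grad x T"
      unfolding r_def using T assms(2,3) by (intro bregman_ge[OF prox]) auto
    moreover have "l * norm g * r \<le> 1/2 * (l * norm g)\<^sup>2 + 1/2 * r\<^sup>2"
      using sum_squares_bound[of "l * norm g" r] by simp
    ultimately show "step_objective d grad g x l T \<le> 1/2 * (l * norm g)\<^sup>2"
      by (simp add: step_objective_def)
  qed (use assms(3) in auto)
  then have "h\<^sup>2 \<le> (l * norm g)\<^sup>2" using len by (simp add: is_step_length_def)
  then show ?thesis using l by (auto intro: power2_le_imp_le)
qed

section \<open>The divergence delay and the summation window\<close>

lemma divergence_delay_sum_ge:
  assumes "filterlim (\<lambda>n. \<Sum>k<n. (\<tau> k)\<^sup>2) at_top sequentially"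
  shows "1 \<le> (\<Sum>i=k..k + divergence_delay \<tau> k. (\<tau> i)\<^sup>2)"
  unfolding divergence_delay_def
proof (rule LeastI_ex)
  have "\<forall>\<^sub>F n in sequentially. (\<Sum>i<k. (\<tau> i)\<^sup>2) + 1 \<le> (\<Sum>i<n. (\<tau> i)\<^sup>2) \<and> k < n"
    using assms eventually_gt_at_top by (auto simp: filterlim_at_top intro: eventually_conj)
  then obtain n where n: "(\<Sum>i<k. (\<tau> i)\<^sup>2) + 1 \<le> (\<Sum>i<n. (\<tau> i)\<^sup>2)" "k < n"
    by (auto simp: eventually_sequentially)
  \<comment> \<open>A delay a spans a + 1 terms, so the block from \<open>k\<close> up to the last
    index n - 1 has delay n - 1 - k.\<close>
  have "{..<n} = {..<k} \<union> {k..k + (n - 1 - k)}" using n(2) by auto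
  then have "(\<Sum>i<n. (\<tau> i)\<^sup>2) = (\<Sum>i<k. (\<tau> i)\<^sup>2) + (\<Sum>i=k..k + (n - 1 - k). (\<tau> i)\<^sup>2)"
    by (simp add: sum.union_disjoint disjoint_iff)
  then show "\<exists>a. 1 \<le> (\<Sum>i=k..k + a. (\<tau> i)\<^sup>2)" using n(1) by (intro exI[of _ "n - 1 - k"]) linarith
qed

text \<open>The hypothesis on \<open>N\<close> puts 0 into the finite set defining
  \<open>window_start\<close>, so the maximum is itself a member. Its delay block therefore ends
  before \<open>N\<close>, and the window contains it.\<close>

lemma window_sum_ge:
  assumes lim: "filterlim (\<lambda>n. \<Sum>k<n. (\<tau> k)\<^sup>2) at_top sequentially"
    and N: "1 + divergence_delay \<tau> 0 \<le> N"
  shows "window_start \<tau> N < N" "1 \<le> (\<Sum>k=window_start \<tau> N..<N. (\<tau> k)\<^sup>2)"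
proof -
  let ?S = "{k. k + divergence_delay \<tau> k \<le> N - 1}" and ?w = "window_start \<tau> N"
  have "finite ?S" by (rule finite_subset[of _ "{..N}"]) auto
  moreover have "0 \<in> ?S" using N by simp
  ultimately have "?w \<in> ?S" unfolding window_start_def by (intro Max_in) blast+
  then have w: "?w + divergence_delay \<tau> ?w < N" using N by simp
  then show "?w < N" by simp
  have "1 \<le> (\<Sum>i=?w..?w + divergence_delay \<tau> ?w. (\<tau> i)\<^sup>2)"
    by (rule divergence_delay_sum_ge[OF lim])
  also have "\<dots> \<le> (\<Sum>k=?w..<N. (\<tau> k)\<^sup>2)" using w by (intro sum_mono2) auto
  finally show "1 \<le> (\<Sum>k=?w..<N. (\<tau> k)\<^sup>2)" .
qed

section \<open>Invariants of a run and summation over the window\<close>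

lemma switching_run_step:
  assumes "switching_subgradient_run Q d grad m f f' h x lam idx"
  shows "x k \<in> Q" "0 < h k" "idx k \<le> m" "0 < lam (idx k) k"
    "is_step_length Q d grad (f' (idx k) (x k)) (x k) (h k) (lam (idx k) k)"
    "is_step_point Q d grad (f' (idx k) (x k)) (x k) (lam (idx k) k) (x (Suc k))"
    "\<And>i. i \<in> {1..m} \<Longrightarrow> is_step_length Q d grad (f' i (x k)) (x k) (h k) (lam i k)"
    "idx k \<noteq> 0 \<Longrightarrow> (h k)\<^sup>2 \<le> lam (idx k) k * f (idx k) (x k)"
    "\<And>i. idx k = 0 \<Longrightarrow> i \<in> {1..m} \<Longrightarrow> lam i k * f i (x k) < (h k)\<^sup>2"
proof -
  note run = assms[unfolded switching_subgradient_run_def]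
  show *: "is_step_point Q d grad (f' (idx k) (x k)) (x k) (lam (idx k) k) (x (Suc k))" for k
    using run by blast
  show "x k \<in> Q"
    using run is_step_pointD(1)[OF *] by (cases k) auto
  show "0 < h k" using run by blast
  show len: "is_step_length Q d grad (f' i (x k)) (x k) (h k) (lam i k)" if "i \<in> {1..m}" for i
    using run that by blast
  have sel: "if \<exists>i\<in>{1..m}. lam i k * f i (x k) \<ge> (h k)\<^sup>2
         then idx k \<in> {1..m} \<and> lam (idx k) k * f (idx k) (x k) \<ge> (h k)\<^sup>2
         else idx k = 0 \<and> is_step_length Q d grad (f' 0 (x k)) (x k) (h k) (lam 0 k)"
    using run by blast
  then show "idx k \<le> m" by (auto split: if_splits)
  show l: "is_step_length Q d grad (f' (idx k) (x k)) (x k) (h k) (lam (idx k) k)"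
    using sel len by (auto split: if_splits)
  then show "0 < lam (idx k) k" by (simp add: is_step_length_def)
  show "idx k \<noteq> 0 \<Longrightarrow> (h k)\<^sup>2 \<le> lam (idx k) k * f (idx k) (x k)"
    using sel by (auto split: if_splits)
  show "\<And>i. idx k = 0 \<Longrightarrow> i \<in> {1..m} \<Longrightarrow> lam i k * f i (x k) < (h k)\<^sup>2"
    using sel by (auto simp: not_le split: if_splits)
qed

lemma active_steps_eq:
  assumes "window_start \<tau> N < N"
  shows "active_steps \<tau> idx N i = {k \<in> {window_start \<tau> N..<N}. idx k = i}"
  using assms by (auto simp: active_steps_def)

text \<open>Serves two purposes: \<open>y = xstar\<close> yields nonemptiness of the set of
  objective steps, and arbitrary \<open>y\<close> yields the bound by the dual function. The first
  use depends on strictness, inherited from \<open>D\<close>.\<close>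

lemma window_bound:
  fixes N :: nat
  assumes prox: "prox_function X d grad" and "Q \<subseteq> X" "convex Q"
    and sub: "\<And>i y. i \<le> m \<Longrightarrow> y \<in> Q \<Longrightarrow> is_subgradient_on Q (f i) y (f' i y)"
    and D: "\<And>y z. y \<in> Q \<Longrightarrow> z \<in> Q \<Longrightarrow> bregman d grad y z < D"
    and lim: "filterlim (\<lambda>n. \<Sum>k<n. (\<tau> k)\<^sup>2) at_top sequentially"
    and h: "\<And>k. h k = sqrt (2 * D) * \<tau> k"
    and run: "switching_subgradient_run Q d grad m f f' h x lam idx"
    and N: "1 + divergence_delay \<tau> 0 \<le> N"
    and y: "y \<in> Q"
  shows "(\<Sum>k\<in>active_steps \<tau> idx N 0. lam (idx k) k * f 0 (x k))
    < active_weight \<tau> lam idx N 0 * f 0 y + (\<Sum>i=1..m. active_weight \<tau> lam idx N i * f i y)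
      + (\<Sum>k\<in>active_steps \<tau> idx N 0. (h k)\<^sup>2)"
proof -
  note R = switching_run_step[OF run]
  define w where "w = window_start \<tau> N"
  define W where "W = {w..<N}"
  define A where "A = active_steps \<tau> idx N 0"
  have w: "w < N" and sum\<tau>: "1 \<le> (\<Sum>k\<in>W. (\<tau> k)\<^sup>2)"
    using window_sum_ge[OF lim N] by (auto simp: w_def W_def)
  have act: "active_steps \<tau> idx N i = {k \<in> W. idx k = i}" for i
    using active_steps_eq w by (simp add: w_def W_def)
  have finW: "finite W" by (simp add: W_def)
  have nonneg: "0 \<le> bregman d grad (x k) y" for k
    using bregman_nonneg[OF prox] R(1) y assms(2) by blast
  \<comment> \<open>Positivity makes the square of \<open>sqrt (2 * D)\<close> equal to
    \<open>2 * D\<close> in \<open>sumh\<close>.\<close>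
  have D0: "0 < D" using nonneg[of 0] D[OF R(1) y, of 0] by linarith
  have sumh: "(\<Sum>k\<in>W. (h k)\<^sup>2) = 2 * D * (\<Sum>k\<in>W. (\<tau> k)\<^sup>2)"
    using D0 by (simp add: h power_mult_distrib sum_distrib_left)
  have step: "lam (idx k) k * (f (idx k) (x k) - f (idx k) y)
      \<le> (bregman d grad (x k) y - bregman d grad (x (Suc k)) y) + 1/2 * (h k)\<^sup>2" for k
  proof -
    have "f (idx k) (x k) - f (idx k) y \<le> blinfun_apply (f' (idx k) (x k)) (x k - y)"
      using sub[OF R(3)[of k] R(1)[of k]] y by (auto simp: is_subgradient_on_def blinfun.diff_right)
    then have "lam (idx k) k * (f (idx k) (x k) - f (idx k) y)
        \<le> lam (idx k) k * blinfun_apply (f' (idx k) (x k)) (x k - y)"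
      using R(4)[of k] by simp
    also have "\<dots> \<le> bregman d grad (x k) y - bregman d grad (x (Suc k)) y + 1/2 * (h k)\<^sup>2"
      by (rule step_point_descent[OF prox assms(2,3) R(6) R(5) y])
    finally show ?thesis .
  qed
  have "(\<Sum>k\<in>W. lam (idx k) k * (f (idx k) (x k) - f (idx k) y))
      \<le> (\<Sum>k\<in>W. (bregman d grad (x k) y - bregman d grad (x (Suc k)) y) + 1/2 * (h k)\<^sup>2)"
    by (rule sum_mono[OF step])
  also have "\<dots> = (\<Sum>k=w..<N. bregman d grad (x k) y - bregman d grad (x (Suc k)) y)
      + 1/2 * (\<Sum>k\<in>W. (h k)\<^sup>2)"
    by (simp add: sum.distrib sum_distrib_left W_def)
  also have "(\<Sum>k=w..<N. bregman d grad (x k) y - bregman d grad (x (Suc k)) y)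
      = bregman d grad (x w) y - bregman d grad (x N) y"
    using sum_Suc_diff'[of w N "\<lambda>k. - bregman d grad (x k) y"] w by simp
  also have "\<dots> < D" using D[OF R(1) y, of w] nonneg[of N] by linarith
  also have "D \<le> 1/2 * (\<Sum>k\<in>W. (h k)\<^sup>2)" using sum\<tau> D0 by (simp add: sumh)
  finally have "(\<Sum>k\<in>W. lam (idx k) k * f (idx k) (x k))
      < (\<Sum>k\<in>W. lam (idx k) k * f (idx k) y) + (\<Sum>k\<in>W. (h k)\<^sup>2)"
    by (simp add: right_diff_distrib sum_subtractf)
  moreover have split: "(\<Sum>k\<in>W. F k) = (\<Sum>k\<in>A. F k) + (\<Sum>k\<in>W - A. F k)" for F :: "nat \<Rightarrow> real"
    using sum.subset_diff[of A W F] finW by (simp add: A_def act)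
  moreover have "(\<Sum>k\<in>W - A. (h k)\<^sup>2) \<le> (\<Sum>k\<in>W - A. lam (idx k) k * f (idx k) (x k))"
    by (rule sum_mono, rule R(8)) (auto simp: A_def act)
  moreover have "(\<Sum>k\<in>A. lam (idx k) k * f (idx k) (x k)) = (\<Sum>k\<in>A. lam (idx k) k * f 0 (x k))"
    by (rule sum.cong) (auto simp: A_def act)
  moreover have "(\<Sum>k\<in>W. lam (idx k) k * f (idx k) y)
      = active_weight \<tau> lam idx N 0 * f 0 y + (\<Sum>i=1..m. active_weight \<tau> lam idx N i * f i y)"
  proof -
    \<comment> \<open>Grouping the steps by selected index, which lies in \<open>{0..m}\<close>,
      produces the weights of the Lagrangian.\<close>
    have "(\<Sum>k\<in>W. lam (idx k) k * f (idx k) y)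
        = (\<Sum>i=0..m. \<Sum>k\<in>{k \<in> W. idx k = i}. lam (idx k) k * f (idx k) y)"
      by (rule sum.group[symmetric]) (use finW R(3) in auto)
    also have "\<dots> = (\<Sum>i=0..m. active_weight \<tau> lam idx N i * f i y)"
      by (intro sum.cong refl) (simp add: active_weight_def act sum_distrib_right)
    finally show ?thesis by (simp add: sum.atLeast_Suc_atMost)
  qed
  ultimately show ?thesis
    using split[of "\<lambda>k. (h k)\<^sup>2"] split[of "\<lambda>k. lam (idx k) k * f (idx k) (x k)"]
    by (simp add: A_def)
qed

section \<open>Nonemptiness, near-feasibility and the duality gap\<close>

theorem theorem5:
  fixes Q X :: "'a::real_normed_vector set"
    and d :: "'a \<Rightarrow> real" and grad :: "'a \<Rightarrow> ('a \<Rightarrow>\<^sub>L real)" and D :: real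
    and m :: nat
    and f :: "nat \<Rightarrow> 'a \<Rightarrow> real" and f' :: "nat \<Rightarrow> 'a \<Rightarrow> ('a \<Rightarrow>\<^sub>L real)"
    and xstar :: 'a
    and \<tau> h :: "nat \<Rightarrow> real"
    and x :: "nat \<Rightarrow> 'a" and lam :: "nat \<Rightarrow> nat \<Rightarrow> real" and idx :: "nat \<Rightarrow> nat"
    and N :: nat
  assumes "finite_dimensional TYPE('a)"
    and "closed Q" and "convex Q" and "bounded Q"
    and "\<And>i. i \<le> m \<Longrightarrow> closed (epigraph Q (f i))"
    and "\<And>i. i \<le> m \<Longrightarrow> convex_on Q (f i)"
    and "\<And>i y. i \<le> m \<Longrightarrow> y \<in> Q \<Longrightarrow> is_subgradient_on Q (f i) y (f' i y)"
    and "prox_function X d grad" and "Q \<subseteq> X"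
    and "\<And>y z. y \<in> Q \<Longrightarrow> z \<in> Q \<Longrightarrow> bregman d grad y z < D"
    and "is_arg_min (f 0) (\<lambda>y. y \<in> Q \<and> (\<forall>i\<in>{1..m}. f i y \<le> 0)) xstar"
    and "\<And>k. \<tau> k \<ge> \<tau> (Suc k) \<and> \<tau> (Suc k) > 0"
    and "filterlim (\<lambda>n. \<Sum>k<n. (\<tau> k)\<^sup>2) at_top sequentially"
    and "\<And>k. h k = sqrt (2 * D) * \<tau> k"
    and "switching_subgradient_run Q d grad m f f' h x lam idx"
    and "N \<ge> 1 + divergence_delay \<tau> 0"
  shows "active_steps \<tau> idx N 0 \<noteq> {} \<and>
    (\<forall>M :: nat \<Rightarrow> real. (\<forall>i\<le>m. \<forall>y\<in>Q. dual_norm (f' i y) \<le> M i) \<longrightarrow>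
      (\<forall>k\<in>active_steps \<tau> idx N 0. \<forall>i\<in>{1..m}.
         f i (x k) \<le> dual_norm (f' i (x k)) * h k \<and>
         dual_norm (f' i (x k)) * h k \<le> M i * h (window_start \<tau> N)) \<and>
      1 / active_weight \<tau> lam idx N 0 *
          (\<Sum>k\<in>active_steps \<tau> idx N 0. lam (idx k) k * f 0 (x k))
        \<le> dual_function Q m f (dual_multiplier \<tau> lam idx N) + M 0 * h (window_start \<tau> N))"
proof (intro conjI allI impI ballI)
  let ?A = "active_steps \<tau> idx N 0" and ?w = "window_start \<tau> N" and ?\<sigma> = "active_weight \<tau> lam idx N"
  note prox = assms(8) and QX = assms(9) and run = assms(15)
  note R = switching_run_step[OF run]
  have bound: "(\<Sum>k\<in>?A. lam (idx k) k * f 0 (x k))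
      < ?\<sigma> 0 * f 0 y + (\<Sum>i=1..m. ?\<sigma> i * f i y) + (\<Sum>k\<in>?A. (h k)\<^sup>2)" if "y \<in> Q" for y
    by (rule window_bound) (fact assms that)+
  have act: "?A \<subseteq> {k. ?w \<le> k \<and> idx k = 0}" by (auto simp: active_steps_def)
  have finA: "finite ?A" by (rule finite_subset[of _ "{..N}"]) (auto simp: active_steps_def)
  have \<sigma>: "0 \<le> ?\<sigma> i" for i
    unfolding active_weight_def by (intro sum_nonneg less_imp_le R(4))
  show ne: "?A \<noteq> {}"
  proof
    \<comment> \<open>Without objective steps, \<open>bound\<close> at the feasible point
      \<open>xstar\<close> says that 0 is strictly below a sum of nonpositive terms.\<close>
    assume A: "?A = {}"
    have xs: "xstar \<in> Q" "\<And>i. i \<in> {1..m} \<Longrightarrow> f i xstar \<le> 0"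
      using assms(11) by (auto simp: is_arg_min_def)
    have "(\<Sum>i=1..m. ?\<sigma> i * f i xstar) \<le> 0"
      by (intro sum_nonpos mult_nonneg_nonpos \<sigma> xs(2))
    moreover have "?\<sigma> 0 = 0" by (simp add: active_weight_def A)
    ultimately show False using bound[OF xs(1)] A by simp
  qed
  fix M :: "nat \<Rightarrow> real"
  assume M: "\<forall>i\<le>m. \<forall>y\<in>Q. dual_norm (f' i y) \<le> M i"
  have "decseq \<tau>" using assms(12) by (intro decseq_SucI) auto
  moreover have "0 \<le> sqrt (2 * D)"
  proof -
    have "bregman d grad (x 0) (x 0) < D" by (intro assms(10) R(1))
    then show ?thesis by (simp add: bregman_def blinfun.zero_right)
  qed
  ultimately have hw: "h k \<le> h ?w" if "k \<in> ?A" for k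
    using that act by (auto simp: assms(14) decseq_def intro!: mult_left_mono)
  {
    fix k i assume k: "k \<in> ?A" and i: "i \<in> {1..m}"
    have idx: "idx k = 0" using k act by auto
    \<comment> \<open>Here \<open>i\<close> was not selected, but the lengths of all constraints are
      computed in every iteration, so the lower bound applies to \<open>lam i k\<close> too.\<close>
    have h: "h k \<le> lam i k * norm (f' i (x k))"
      by (rule step_length_ge[OF prox QX R(1) R(7)[OF i] R(2)])
    have l: "0 < lam i k" using R(7)[OF i] by (simp add: is_step_length_def)
    have "lam i k * f i (x k) \<le> h k * h k"
      using R(9)[OF idx i] by (simp add: power2_eq_square)
    also have "\<dots> \<le> (lam i k * norm (f' i (x k))) * h k"
      using h R(2)[of k] by (intro mult_right_mono) auto
    finally show "f i (x k) \<le> dual_norm (f' i (x k)) * h k"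
      using l by (simp add: dual_norm_eq_norm mult.assoc)
    have Mi: "norm (f' i (x k)) \<le> M i" using M i R(1) by (auto simp: dual_norm_eq_norm)
    then show "dual_norm (f' i (x k)) * h k \<le> M i * h ?w"
      unfolding dual_norm_eq_norm
      using hw[OF k] R(2)[of k] order_trans[OF norm_ge_zero Mi] by (intro mult_mono) auto
  }
  have \<sigma>0: "0 < ?\<sigma> 0"
    unfolding active_weight_def by (intro sum_pos finA ne R(4))
  \<comment> \<open>The two factors of the square are treated differently: one is bounded by
    \<lambda> times \<open>M 0\<close>, the other by the largest step bound \<open>h ?w\<close> in
    the window.\<close>
  have h2: "(\<Sum>k\<in>?A. (h k)\<^sup>2) \<le> ?\<sigma> 0 * (M 0 * h ?w)"
    unfolding active_weight_def sum_distrib_right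
  proof (rule sum_mono)
    fix k assume k: "k \<in> ?A"
    have idx: "idx k = 0" using k act by auto
    have "h k \<le> lam (idx k) k * norm (f' (idx k) (x k))"
      by (rule step_length_ge[OF prox QX R(1) R(5) R(2)])
    also have "\<dots> \<le> lam (idx k) k * M 0"
      using M R(1) R(4)[of k] idx by (auto simp: dual_norm_eq_norm)
    finally have "h k * h k \<le> (lam (idx k) k * M 0) * h ?w"
      using hw[OF k] R(2)[of k] by (intro mult_mono) auto
    then show "(h k)\<^sup>2 \<le> lam (idx k) k * (M 0 * h ?w)" by (simp add: power2_eq_square mult.assoc)
  qed
  let ?L = "\<Sum>k\<in>?A. lam (idx k) k * f 0 (x k)"
  \<comment> \<open>With the error term moved to the left, the left side is independent of
    \<open>y\<close>, and it suffices to bound the Lagrangian below at each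
    \<open>y\<close>.\<close>
  have "1 / ?\<sigma> 0 * ?L - M 0 * h ?w \<le> dual_function Q m f (dual_multiplier \<tau> lam idx N)"
    unfolding dual_function_def
  proof (rule cINF_greatest)
    fix y assume y: "y \<in> Q"
    have "?L \<le> ?\<sigma> 0 * f 0 y + (\<Sum>i=1..m. ?\<sigma> i * f i y) + ?\<sigma> 0 * (M 0 * h ?w)"
      using bound[OF y] h2 by linarith
    also have "(\<Sum>i=1..m. ?\<sigma> i * f i y) = ?\<sigma> 0 * (\<Sum>i=1..m. dual_multiplier \<tau> lam idx N i * f i y)"
      using \<sigma>0 by (simp add: sum_distrib_left dual_multiplier_def)
    finally show "1 / ?\<sigma> 0 * ?L - M 0 * h ?w
        \<le> f 0 y + (\<Sum>i=1..m. dual_multiplier \<tau> lam idx N i * f i y)"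
      using \<sigma>0 by (simp add: divide_simps algebra_simps)
  qed (use R(1) in auto)
  then show "1 / ?\<sigma> 0 * ?L \<le> dual_function Q m f (dual_multiplier \<tau> lam idx N) + M 0 * h ?w"
    by simp
qed

end
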